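(* Let $\mathcal{M}$ be a smooth Riemannian manifold with Riemannian metric $\langle\cdot,\cdot\rangle_x$, let $f:\mathcal{M}\to\mathbb{R}$ be of class $C^1$ and bounded from below, and let $R:T\mathcal{M}\to\mathcal{M}$ be a retraction on $\mathcal{M}$. Suppose that there exists $L>0$ such that $$f(R_x(\xi))\le f(x)+\langle\mathrm{grad} f(x),\xi\rangle_x+\frac{L}{2}\|\xi\|_x^2\quad\text{for all }(x,\xi)\in T\mathcal{M}.$$ Let $\{x^k\}$ be a sequence generated by the auto-conditioned Riemannian gradient method (AC-RGM) with parameters $\alpha>\frac12$, $L_0>0$ and $x^0\in\mathcal{M}$, satisfying $\mathrm{grad} f(x^{k-1})\ne0_{x^{k-1}}$ for all $k\ge1$. Then: (i) For all $k\ge1$, $$\min_{1\le l\le k}\|\mathrm{grad} f(x^{l-1})\|_{x^{l-1}}\le\sqrt{\frac{2\max\{L_0,L\}(2\alpha^2L_0^2\Delta+C)}{(2\alpha-1)L_0^2k}}=\mathcal{O}(k^{-\frac12}),$$ where $f^*:=\inf_{x\in\mathcal{M}}f(x)$, $\Delta:=f(x^0)-f^*$, and $C:=(\max\{L_0,L\}-L_0)\max_{l\in\overline{\mathcal{S}}}\|\mathrm{grad} f(x^{l-1})\|_{x^{l-1}}^2<\infty$. (ii) The sequence $\{f(x^k)\}$ converges to a finite value, and any accumulation point $x^*$ of $\{x^k\}$ is a stationary point of the problem of minimizing $f$ over $\mathcal{M}$, i.e. $\mathrm{grad} f(x^* )=0_{x^*}$.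
   Context: $T_x\mathcal{M}$ is the tangent space at $x$, $T\mathcal{M}$ the tangent bundle, $0_x$ the zero of $T_x\mathcal{M}$, $\mathrm{grad} f(x)\in T_x\mathcal{M}$ the Riemannian gradient, and $\|\xi\|_x=\sqrt{\langle\xi,\xi\rangle_x}$. A retraction is a (smooth) map $R:T\mathcal{M}\to\mathcal{M}$, with $R_x$ its restriction to $T_x\mathcal{M}$, such that for all $x\in\mathcal{M}$, $R_x(0_x)=x$ and the differential $\mathrm{D}R_x(0_x)$ is the identity map on $T_x\mathcal{M}$. AC-RGM: given $x^0\in\mathcal{M}$, $\alpha>\frac12$, $L_0>0$, for $k=1,2,\dots$ compute $\gamma_k=\max\{L_0,\dots,L_{k-1}\}$; $\tau_k=\frac{1}{\alpha\gamma_k}$; $x^k=R_{x^{k-1}}(-\tau_k\,\mathrm{grad} f(x^{k-1}))$; $L_k=\dfrac{2\big(f(x^k)-f(x^{k-1})-\langle\mathrm{grad} f(x^{k-1}),-\tau_k\,\mathrm{grad} f(x^{k-1})\rangle_{x^{k-1}}\big)}{\|\tau_k\,\mathrm{grad} f(x^{k-1})\|_{x^{k-1}}^2}$. Index sets: with $\beta:=\alpha+\frac12$, $\mathcal{S}:=\{k\ge1\mid\beta\gamma_k\ge L_k\}$ and $\overline{\mathcal{S}}:=\{1,2,\dots\}\setminus\mathcal{S}$. A maximum over the empty set is taken to be $0$. *)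

theory Defs
  imports
    "HOL-Analysis.Analysis"
    "HOL-Library.Function_Algebras"
    "HOL-Library.Landau_Symbols"
begin

text \<open>
  Pointwise scalar multiplication; together with the pointwise group structure of
  \<^theory>\<open>HOL-Library.Function_Algebras\<close> it makes the tangent vectors below
  elements of a real vector space.
\<close>

instantiation "fun" :: (type, real_vector) real_vector
begin

definition scaleR_fun :: "real \<Rightarrow> ('a \<Rightarrow> 'b) \<Rightarrow> 'a \<Rightarrow> 'b"
  where "scaleR_fun a f = (\<lambda>x. a *\<^sub>R f x)"

instance
  by standard (auto simp: scaleR_fun_def plus_fun_def fun_eq_iff algebra_simps)

end

section \<open>Differentiability classes on open subsets of Euclidean spaces\<close>

text \<open>
  Only meant for open \<open>S\<close>. The domain is finite-dimensional, so asking every directional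
  derivative to be of class \<open>C\<^sup>k\<close> is the same as asking it of the derivative as an
  operator-valued map.
\<close>

primrec Ck_on :: "nat \<Rightarrow> 'a::euclidean_space set \<Rightarrow> ('a \<Rightarrow> 'b::real_normed_vector) \<Rightarrow> bool" where
  "Ck_on 0 S f \<longleftrightarrow> continuous_on S f"
| "Ck_on (Suc k) S f \<longleftrightarrow> (\<forall>x\<in>S. f differentiable (at x)) \<and>
     (\<forall>v. Ck_on k S (\<lambda>x. frechet_derivative f (at x) v))"

definition smooth_on :: "'a::euclidean_space set \<Rightarrow> ('a \<Rightarrow> 'b::real_normed_vector) \<Rightarrow> bool"
  where "smooth_on S f \<longleftrightarrow> (\<forall>k. Ck_on k S f)"

section \<open>Smooth manifolds\<close>

text \<open>
  A chart is a pair of its domain and its coordinate map; the values of the map outside the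
  domain are irrelevant. The manifold is the underlying set of a topology \<open>X\<close>, with a
  smooth atlas \<open>A\<close> that need not be maximal.
\<close>

type_synonym ('m, 'e) chart = "'m set \<times> ('m \<Rightarrow> 'e)"

definition chart_inv :: "('m, 'e) chart \<Rightarrow> 'e \<Rightarrow> 'm"
  where "chart_inv c = inv_into (fst c) (snd c)"

definition chart_range :: "('m, 'e) chart \<Rightarrow> 'e set"
  where "chart_range c = snd c ` fst c"

definition smooth_manifold ::
  "'m topology \<Rightarrow> ('m, 'e::euclidean_space) chart set \<Rightarrow> bool" where
  "smooth_manifold X A \<longleftrightarrow>
     Hausdorff_space X \<and> second_countable X \<and>
     (\<Union>c\<in>A. fst c) = topspace X \<and>
     (\<forall>c\<in>A. openin X (fst c) \<and> open (chart_range c) \<and>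
        homeomorphic_map (subtopology X (fst c)) (top_of_set (chart_range c)) (snd c)) \<and>
     (\<forall>c\<in>A. \<forall>d\<in>A. smooth_on (snd c ` (fst c \<inter> fst d)) (snd d \<circ> chart_inv c))"

section \<open>Tangent vectors\<close>

text \<open>
  A tangent vector at \<open>x\<close> is the family of its coordinates in all charts around \<open>x\<close>,
  which transform by the derivatives of the chart transitions. The family is \<open>0\<close> at
  the irrelevant indices, so that vector operations and equality are those of functions.
\<close>

type_synonym ('m, 'e) tangent = "('m, 'e) chart \<Rightarrow> 'e"

definition charts_at :: "('m, 'e) chart set \<Rightarrow> 'm \<Rightarrow> ('m, 'e) chart set"
  where "charts_at A x = {c \<in> A. x \<in> fst c}"

definition tangent_space ::
  "('m, 'e::euclidean_space) chart set \<Rightarrow> 'm \<Rightarrow> ('m, 'e) tangent set" where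
  "tangent_space A x = {\<xi>.
     (\<forall>c. c \<notin> charts_at A x \<longrightarrow> \<xi> c = 0) \<and>
     (\<forall>c\<in>charts_at A x. \<forall>d\<in>charts_at A x.
        \<xi> d = frechet_derivative (snd d \<circ> chart_inv c) (at (snd c x)) (\<xi> c))}"

definition tangent_bundle ::
  "'m topology \<Rightarrow> ('m, 'e::euclidean_space) chart set \<Rightarrow> ('m \<times> ('m, 'e) tangent) set"
  where "tangent_bundle X A = (SIGMA x:topspace X. tangent_space A x)"

text \<open>The tangent vector at \<open>x\<close> that has coordinates \<open>v\<close> in the chart \<open>c\<close> around \<open>x\<close>.\<close>

definition tangent_of ::
  "('m, 'e::euclidean_space) chart set \<Rightarrow> ('m, 'e) chart \<Rightarrow> 'm \<Rightarrow> 'e \<Rightarrow> ('m, 'e) tangent" where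
  "tangent_of A c x v = (\<lambda>d. if d \<in> charts_at A x
     then frechet_derivative (snd d \<circ> chart_inv c) (at (snd c x)) v else 0)"

section \<open>Riemannian metrics and gradients\<close>

definition riemannian_metric ::
  "'m topology \<Rightarrow> ('m, 'e::euclidean_space) chart set \<Rightarrow>
   ('m \<Rightarrow> ('m, 'e) tangent \<Rightarrow> ('m, 'e) tangent \<Rightarrow> real) \<Rightarrow> bool" where
  "riemannian_metric X A g \<longleftrightarrow>
     (\<forall>x\<in>topspace X. \<forall>\<xi>\<in>tangent_space A x. \<forall>\<eta>\<in>tangent_space A x.
        g x \<xi> \<eta> = g x \<eta> \<xi> \<and>
        (\<forall>\<zeta>\<in>tangent_space A x. g x (\<xi> + \<eta>) \<zeta> = g x \<xi> \<zeta> + g x \<eta> \<zeta>) \<and>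
        (\<forall>a. g x (a *\<^sub>R \<xi>) \<eta> = a * g x \<xi> \<eta>) \<and>
        (\<xi> \<noteq> 0 \<longrightarrow> g x \<xi> \<xi> > 0)) \<and>
     (\<forall>c\<in>A. \<forall>v w. smooth_on (chart_range c)
        (\<lambda>u. g (chart_inv c u) (tangent_of A c (chart_inv c u) v)
                               (tangent_of A c (chart_inv c u) w)))"

definition riemannian_manifold ::
  "'m topology \<Rightarrow> ('m, 'e::euclidean_space) chart set \<Rightarrow>
   ('m \<Rightarrow> ('m, 'e) tangent \<Rightarrow> ('m, 'e) tangent \<Rightarrow> real) \<Rightarrow> bool"
  where "riemannian_manifold X A g \<longleftrightarrow> smooth_manifold X A \<and> riemannian_metric X A g"

definition tnorm ::
  "('m \<Rightarrow> ('m, 'e) tangent \<Rightarrow> ('m, 'e) tangent \<Rightarrow> real) \<Rightarrow> 'm \<Rightarrow> ('m, 'e) tangent \<Rightarrow> real"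
  where "tnorm g x \<xi> = sqrt (g x \<xi> \<xi>)"

definition C1_function :: "('m, 'e::euclidean_space) chart set \<Rightarrow> ('m \<Rightarrow> real) \<Rightarrow> bool"
  where "C1_function A f \<longleftrightarrow> (\<forall>c\<in>A. Ck_on 1 (chart_range c) (f \<circ> chart_inv c))"

text \<open>
  By the chain rule, neither this differential nor the one used for retractions below
  depends on the chart chosen.
\<close>

definition differential ::
  "('m, 'e::euclidean_space) chart set \<Rightarrow> ('m \<Rightarrow> real) \<Rightarrow> 'm \<Rightarrow> ('m, 'e) tangent \<Rightarrow> real" where
  "differential A f x \<xi> =
     (let c = (SOME c. c \<in> charts_at A x)
      in frechet_derivative (f \<circ> chart_inv c) (at (snd c x)) (\<xi> c))"

definition grad ::
  "('m, 'e::euclidean_space) chart set \<Rightarrow>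
   ('m \<Rightarrow> ('m, 'e) tangent \<Rightarrow> ('m, 'e) tangent \<Rightarrow> real) \<Rightarrow>
   ('m \<Rightarrow> real) \<Rightarrow> 'm \<Rightarrow> ('m, 'e) tangent" where
  "grad A g f x = (THE \<eta>. \<eta> \<in> tangent_space A x \<and>
     (\<forall>\<xi>\<in>tangent_space A x. g x \<eta> \<xi> = differential A f x \<xi>))"

section \<open>Retractions\<close>

text \<open>
  Charts \<open>c\<close> of the manifold induce the charts \<open>(y, \<xi>) \<mapsto> (snd c y, \<xi> c)\<close> of the tangent
  bundle. Openness of the preimages of chart domains expresses continuity.
\<close>

definition smooth_bundle_map ::
  "('m, 'e::euclidean_space) chart set \<Rightarrow> ('m \<Rightarrow> ('m, 'e) tangent \<Rightarrow> 'm) \<Rightarrow> bool" where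
  "smooth_bundle_map A R \<longleftrightarrow> (\<forall>c\<in>A. \<forall>d\<in>A.
     let F = (\<lambda>(u, v). R (chart_inv c u) (tangent_of A c (chart_inv c u) v));
         W = {p \<in> chart_range c \<times> UNIV. F p \<in> fst d}
     in open W \<and> smooth_on W (snd d \<circ> F))"

text \<open>
  Differential at \<open>\<eta>\<close> of a map \<open>F\<close> from the vector space \<open>tangent_space A x\<close> to the
  manifold; the tangent space of that vector space is identified with the space itself.
\<close>

definition fibre_differential ::
  "('m, 'e::euclidean_space) chart set \<Rightarrow> 'm \<Rightarrow> (('m, 'e) tangent \<Rightarrow> 'm) \<Rightarrow>
   ('m, 'e) tangent \<Rightarrow> ('m, 'e) tangent \<Rightarrow> ('m, 'e) tangent" where
  "fibre_differential A x F \<eta> \<xi> =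
     (let c = (SOME c. c \<in> charts_at A x)
      in (\<lambda>d. if d \<in> charts_at A (F \<eta>)
           then frechet_derivative (\<lambda>v. snd d (F (tangent_of A c x v))) (at (\<eta> c)) (\<xi> c)
           else 0))"

definition manifold_retraction ::
  "'m topology \<Rightarrow> ('m, 'e::euclidean_space) chart set \<Rightarrow>
   ('m \<Rightarrow> ('m, 'e) tangent \<Rightarrow> 'm) \<Rightarrow> bool" where
  "manifold_retraction X A R \<longleftrightarrow>
     (\<forall>(x, \<xi>)\<in>tangent_bundle X A. R x \<xi> \<in> topspace X) \<and>
     smooth_bundle_map A R \<and>
     (\<forall>x\<in>topspace X. R x 0 = x \<and>
        (\<forall>\<xi>\<in>tangent_space A x. fibre_differential A x (R x) 0 \<xi> = \<xi>))"

section \<open>The auto-conditioned Riemannian gradient method\<close>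

definition ac_gamma :: "(nat \<Rightarrow> real) \<Rightarrow> nat \<Rightarrow> real"
  where "ac_gamma Ls k = Max (Ls ` {..<k})"

definition ac_tau :: "real \<Rightarrow> (nat \<Rightarrow> real) \<Rightarrow> nat \<Rightarrow> real"
  where "ac_tau \<alpha> Ls k = 1 / (\<alpha> * ac_gamma Ls k)"

text \<open>\<open>x\<close> and \<open>Ls\<close> are the sequences of iterates and of estimates produced by the method.\<close>

definition AC_RGM ::
  "('m, 'e::euclidean_space) chart set \<Rightarrow>
   ('m \<Rightarrow> ('m, 'e) tangent \<Rightarrow> ('m, 'e) tangent \<Rightarrow> real) \<Rightarrow>
   ('m \<Rightarrow> real) \<Rightarrow> ('m \<Rightarrow> ('m, 'e) tangent \<Rightarrow> 'm) \<Rightarrow> real \<Rightarrow> real \<Rightarrow> 'm \<Rightarrow>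
   (nat \<Rightarrow> 'm) \<Rightarrow> (nat \<Rightarrow> real) \<Rightarrow> bool" where
  "AC_RGM A g f R \<alpha> L0 x0 x Ls \<longleftrightarrow>
     x 0 = x0 \<and> Ls 0 = L0 \<and>
     (\<forall>k\<ge>1.
        let G = grad A g f (x (k - 1)); \<tau> = ac_tau \<alpha> Ls k
        in x k = R (x (k - 1)) (- (\<tau> *\<^sub>R G)) \<and>
           Ls k = 2 * (f (x k) - f (x (k - 1)) - g (x (k - 1)) G (- (\<tau> *\<^sub>R G)))
                    / (tnorm g (x (k - 1)) (\<tau> *\<^sub>R G))\<^sup>2)"

definition S_set :: "real \<Rightarrow> (nat \<Rightarrow> real) \<Rightarrow> nat set"
  where "S_set \<alpha> Ls = {k. k \<ge> 1 \<and> (\<alpha> + 1 / 2) * ac_gamma Ls k \<ge> Ls k}"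

definition S_bar :: "real \<Rightarrow> (nat \<Rightarrow> real) \<Rightarrow> nat set"
  where "S_bar \<alpha> Ls = {1..} - S_set \<alpha> Ls"

text \<open>
  \<open>m\<close> is the maximum of \<open>B\<close>, where the maximum of the empty set is \<open>0\<close>. A predicate is
  used because \<open>B\<close> may be infinite, in which case a maximum need not exist.
\<close>

definition is_max0 :: "real \<Rightarrow> real set \<Rightarrow> bool"
  where "is_max0 m B \<longleftrightarrow> (if B = {} then m = 0 else m \<in> B \<and> (\<forall>b\<in>B. b \<le> m))"

end

(*
  By the definition of L_k, a step changes f by exactly
    - tau_k N + (L_k / 2) tau_k^2 N  with  N = |grad f(x^{k-1})|^2,
  and the descent inequality gives L_k <= L, hence L_0 <= gamma_k <= max(L_0, L).
  For k in S this is a decrease by at least (2 alpha - 1) / (4 alpha^2 gamma_k) N.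
  For k outside S, gamma_{k+1} - gamma_k exceeds (alpha - 1/2) L_0, so there are only
  finitely many such k, and the excess over that decrease is at most
  (gamma_{k+1} - gamma_k) N / (2 alpha^2 L_0^2); these excesses telescope.
  Summation gives the rate, grad f(x^k) --> 0 and eventual monotonicity of f(x^k).
  At an accumulation point, fix a coordinate vector v in a chart: by Cauchy-Schwarz the
  derivative of f along v is at most |grad f| |v|, which tends to 0 along the subsequence,
  and it is continuous, so the differential of f vanishes in the limit.
*)

theory Submission
  imports Defs
begin

section \<open>The estimates of the auto-conditioned method\<close>

text \<open>The method reduced to real sequences: \<open>F k\<close> is the value of f and
  \<open>N k\<close> the squared gradient norm at iterate k. \<open>F_Suc\<close> is the definition
  of L_k solved for the new value, \<open>Ls_le\<close> the contribution of the descent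
  inequality.\<close>

locale ac_estimates =
  fixes \<alpha> L0 L :: real and Ls F N :: "nat \<Rightarrow> real"
  assumes alpha: "\<alpha> > 1 / 2" and L0: "L0 > 0" and Ls_0: "Ls 0 = L0"
    and Ls_le: "\<And>k. Ls (Suc k) \<le> L"
    and N_nonneg: "\<And>k. N k \<ge> 0"
    and F_Suc: "\<And>k. F (Suc k) = F k - ac_tau \<alpha> Ls (Suc k) * N k
                  + Ls (Suc k) / 2 * (ac_tau \<alpha> Ls (Suc k))\<^sup>2 * N k"
    and F_bdd: "bdd_below (range F)"
begin

abbreviation \<gamma> :: "nat \<Rightarrow> real" where "\<gamma> \<equiv> ac_gamma Ls"

section \<open>Growth of the estimates and finiteness of \<open>S_bar\<close>\<close>

lemma gamma_1: "\<gamma> (Suc 0) = L0"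
  by (simp add: ac_gamma_def Ls_0 lessThan_Suc)

lemma gamma_Suc_Suc: "\<gamma> (Suc (Suc k)) = max (Ls (Suc k)) (\<gamma> (Suc k))"
proof -
  have "\<gamma> (Suc (Suc k)) = Max (insert (Ls (Suc k)) (Ls ` {..<Suc k}))"
    unfolding ac_gamma_def by (subst lessThan_Suc) simp
  also have "\<dots> = max (Ls (Suc k)) (\<gamma> (Suc k))"
    unfolding ac_gamma_def by (rule Max_insert) auto
  finally show ?thesis .
qed

lemma gamma_le: "\<gamma> (Suc k) \<le> max L0 L"
proof (induction k)
  case 0
  show ?case by (simp add: gamma_1)
next
  case (Suc k)
  with Ls_le[of k] show ?case by (auto simp: gamma_Suc_Suc)
qed

lemma gamma_ge: "L0 \<le> \<gamma> (Suc k)"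
  by (induction k) (auto simp: gamma_1 gamma_Suc_Suc)

lemma gamma_pos: "0 < \<gamma> (Suc k)"
  using gamma_ge[of k] L0 by linarith

text \<open>Here L_k exceeds (\<alpha> + 1/2) gamma_k, so it becomes the new maximum, and the jump
  is more than (\<alpha> - 1/2) gamma_k.\<close>

lemma gamma_step_S_bar:
  assumes "Suc k \<in> S_bar \<alpha> Ls"
  shows "\<gamma> (Suc k) + (\<alpha> - 1 / 2) * L0 \<le> \<gamma> (Suc (Suc k))"
proof -
  have "(\<alpha> - 1 / 2) * L0 \<le> (\<alpha> - 1 / 2) * \<gamma> (Suc k)"
    using alpha gamma_ge by (intro mult_left_mono) auto
  moreover have "(\<alpha> + 1 / 2) * \<gamma> (Suc k) < Ls (Suc k)"
    using assms by (auto simp: S_bar_def S_set_def)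
  ultimately show ?thesis
    by (simp add: gamma_Suc_Suc algebra_simps)
qed

text \<open>\<open>\<gamma>\<close> starts at L_0 and never decreases, and every index of
  \<open>S_bar\<close> adds a jump of fixed size. The jump caused by index n first shows in
  \<open>\<gamma> (Suc n)\<close>.\<close>

lemma card_S_bar_le: "real (card (S_bar \<alpha> Ls \<inter> {..n})) * ((\<alpha> - 1 / 2) * L0) \<le> \<gamma> (Suc n) - L0"
proof (induction n)
  case 0
  have "S_bar \<alpha> Ls \<inter> {..0} = {}"
    by (auto simp: S_bar_def)
  then show ?case by (simp add: gamma_1)
next
  case (Suc n)
  show ?case
  proof (cases "Suc n \<in> S_bar \<alpha> Ls")
    case True
    then have "S_bar \<alpha> Ls \<inter> {..Suc n} = insert (Suc n) (S_bar \<alpha> Ls \<inter> {..n})"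
      by (auto simp: le_Suc_eq)
    with Suc.IH gamma_step_S_bar[OF True] show ?thesis
      by (simp add: algebra_simps)
  next
    case False
    then have "S_bar \<alpha> Ls \<inter> {..Suc n} = S_bar \<alpha> Ls \<inter> {..n}"
      by (auto simp: le_Suc_eq)
    with Suc.IH show ?thesis
      by (simp add: gamma_Suc_Suc)
  qed
qed

lemma finite_S_bar: "finite (S_bar \<alpha> Ls)"
proof -
  have pos: "(\<alpha> - 1 / 2) * L0 > 0"
    using alpha L0 by simp
  \<comment> \<open>The upper bound on \<open>\<gamma>\<close> leaves room for only this many jumps;
    a uniform bound on the size of finite subsets yields finiteness.\<close>
  have "card B \<le> nat \<lceil>(max L0 L - L0) / ((\<alpha> - 1 / 2) * L0)\<rceil>"
    if B: "B \<subseteq> S_bar \<alpha> Ls" "finite B" for B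
  proof -
    obtain n where "B \<subseteq> {..n}"
      using B(2) finite_nat_iff_bounded_le by blast
    with B have "card B \<le> card (S_bar \<alpha> Ls \<inter> {..n})"
      by (intro card_mono) auto
    then have "real (card B) * ((\<alpha> - 1 / 2) * L0)
        \<le> real (card (S_bar \<alpha> Ls \<inter> {..n})) * ((\<alpha> - 1 / 2) * L0)"
      using pos by (intro mult_right_mono) auto
    also have "\<dots> \<le> max L0 L - L0"
      using card_S_bar_le[of n] gamma_le[of n] by linarith
    finally have "real (card B) \<le> (max L0 L - L0) / ((\<alpha> - 1 / 2) * L0)"
      using pos by (simp add: pos_le_divide_eq)
    then show ?thesis by linarith
  qed
  then show ?thesis
    by (metis finite_if_finite_subsets_card_bdd)
qed

section \<open>Change of \<open>F\<close> in a single step\<close>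

lemma F_Suc_eq:
  "F (Suc k) = F k - (2 * \<alpha> - 1) / (4 * \<alpha>\<^sup>2 * \<gamma> (Suc k)) * N k
     + (Ls (Suc k) - (\<alpha> + 1 / 2) * \<gamma> (Suc k)) / (2 * \<alpha>\<^sup>2 * (\<gamma> (Suc k))\<^sup>2) * N k"
proof -
  have "\<alpha> \<noteq> 0" "\<gamma> (Suc k) \<noteq> 0"
    using alpha gamma_pos[of k] by auto
  \<comment> \<open>The coefficient -tau + L_k tau^2 / 2 is split at the threshold L_k = (\<alpha> +
    1/2) gamma_k: its value there is the first term, and the sign of the second decides membership
    in S.\<close>
  then show ?thesis
    unfolding F_Suc ac_tau_def by (simp add: field_simps power2_eq_square)
qed

text \<open>Gives all steps the same descent coefficient, so that they can be summed.\<close>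

lemma descent_coeff_le:
  "(2 * \<alpha> - 1) / (4 * \<alpha>\<^sup>2 * max L0 L) * N k \<le> (2 * \<alpha> - 1) / (4 * \<alpha>\<^sup>2 * \<gamma> (Suc k)) * N k"
  using alpha gamma_pos[of k] gamma_le[of k] N_nonneg[of k]
  by (intro mult_right_mono divide_left_mono mult_left_mono mult_pos_pos) auto

lemma descent_S:
  assumes "Suc k \<notin> S_bar \<alpha> Ls"
  shows "F (Suc k) + (2 * \<alpha> - 1) / (4 * \<alpha>\<^sup>2 * max L0 L) * N k \<le> F k"
proof -
  have "Ls (Suc k) - (\<alpha> + 1 / 2) * \<gamma> (Suc k) \<le> 0"
    using assms by (auto simp: S_bar_def S_set_def)
  then have "(Ls (Suc k) - (\<alpha> + 1 / 2) * \<gamma> (Suc k)) / (2 * \<alpha>\<^sup>2 * (\<gamma> (Suc k))\<^sup>2) * N k \<le> 0"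
    using N_nonneg[of k] by (intro mult_nonpos_nonneg divide_nonpos_nonneg) auto
  then show ?thesis
    using F_Suc_eq[of k] descent_coeff_le[of k] by linarith
qed

text \<open>The possible increase of \<open>F\<close> at an index of \<open>S_bar\<close> is charged to the increase of
  \<open>\<gamma>\<close>, so that these terms telescope.\<close>

lemma descent_S_bar:
  assumes "Suc k \<in> S_bar \<alpha> Ls" and m: "N k \<le> m"
  shows "F (Suc k) + (2 * \<alpha> - 1) / (4 * \<alpha>\<^sup>2 * max L0 L) * N k
           \<le> F k + (\<gamma> (Suc (Suc k)) - \<gamma> (Suc k)) * m / (2 * \<alpha>\<^sup>2 * L0\<^sup>2)"
proof -
  have Lk: "(\<alpha> + 1 / 2) * \<gamma> (Suc k) < Ls (Suc k)"
    using assms by (auto simp: S_bar_def S_set_def)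
  \<comment> \<open>As \<alpha> + 1/2 \<ge> 1, the excess over the threshold is at most L_k -
    gamma_k, hence at most the increase of the maximum.\<close>
  have "1 * \<gamma> (Suc k) \<le> (\<alpha> + 1 / 2) * \<gamma> (Suc k)"
    using alpha gamma_pos[of k] by (intro mult_right_mono) auto
  then have diff: "Ls (Suc k) - (\<alpha> + 1 / 2) * \<gamma> (Suc k) \<le> \<gamma> (Suc (Suc k)) - \<gamma> (Suc k)"
    by (simp add: gamma_Suc_Suc)
  have gap: "0 \<le> \<gamma> (Suc (Suc k)) - \<gamma> (Suc k)"
    using Lk diff by linarith
  have denom: "0 < 2 * \<alpha>\<^sup>2 * L0\<^sup>2" "2 * \<alpha>\<^sup>2 * L0\<^sup>2 \<le> 2 * \<alpha>\<^sup>2 * (\<gamma> (Suc k))\<^sup>2"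
    using alpha L0 gamma_ge[of k] by (simp_all add: power_mono)
  have "(Ls (Suc k) - (\<alpha> + 1 / 2) * \<gamma> (Suc k)) / (2 * \<alpha>\<^sup>2 * (\<gamma> (Suc k))\<^sup>2) * N k
      \<le> (\<gamma> (Suc (Suc k)) - \<gamma> (Suc k)) / (2 * \<alpha>\<^sup>2 * L0\<^sup>2) * m"
    using frac_le[OF gap diff denom] m divide_nonneg_pos[OF gap denom(1)] N_nonneg
    by (rule mult_mono)
  then show ?thesis
    using F_Suc_eq[of k] descent_coeff_le[of k] unfolding times_divide_eq_left by linarith
qed

section \<open>Summation of the descent inequalities\<close>

context
  fixes m
  assumes m: "\<And>k. Suc k \<in> S_bar \<alpha> Ls \<Longrightarrow> N k \<le> m" and m_nonneg: "0 \<le> m"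
begin

text \<open>The increments of \<open>\<gamma>\<close> add up to gamma_{n+1} - gamma_1, where gamma_1
  = L_0. The bound \<open>m\<close> stands for the maximum in the constant C.\<close>

lemma telescoped_descent:
  "F n + (2 * \<alpha> - 1) / (4 * \<alpha>\<^sup>2 * max L0 L) * (\<Sum>k<n. N k)
     \<le> F 0 + (\<gamma> (Suc n) - L0) * m / (2 * \<alpha>\<^sup>2 * L0\<^sup>2)"
proof (induction n)
  case 0
  show ?case by (simp add: gamma_1)
next
  case (Suc n)
  have "F (Suc n) + (2 * \<alpha> - 1) / (4 * \<alpha>\<^sup>2 * max L0 L) * N n
      \<le> F n + (\<gamma> (Suc (Suc n)) - \<gamma> (Suc n)) * m / (2 * \<alpha>\<^sup>2 * L0\<^sup>2)"
  proof (cases "Suc n \<in> S_bar \<alpha> Ls")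
    case True
    with m show ?thesis by (intro descent_S_bar) auto
  next
    case False
    \<comment> \<open>An index of S is granted the increment of \<open>\<gamma>\<close> too; it is
      nonnegative, so both cases give the same inequality.\<close>
    have "0 \<le> (\<gamma> (Suc (Suc n)) - \<gamma> (Suc n)) * m / (2 * \<alpha>\<^sup>2 * L0\<^sup>2)"
      using m_nonneg by (simp add: gamma_Suc_Suc)
    with descent_S[OF False] show ?thesis by linarith
  qed
  moreover have "(\<gamma> (Suc n) - L0) * m / (2 * \<alpha>\<^sup>2 * L0\<^sup>2)
      + (\<gamma> (Suc (Suc n)) - \<gamma> (Suc n)) * m / (2 * \<alpha>\<^sup>2 * L0\<^sup>2)
      = (\<gamma> (Suc (Suc n)) - L0) * m / (2 * \<alpha>\<^sup>2 * L0\<^sup>2)"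
    by (simp add: algebra_simps flip: add_divide_distrib)
  ultimately show ?case
    using Suc.IH unfolding sum.lessThan_Suc distrib_left by linarith
qed

lemma sum_N_le:
  assumes "\<And>k. fstar \<le> F k"
  shows "(\<Sum>k<n. N k) \<le> 2 * max L0 L * (2 * \<alpha>\<^sup>2 * L0\<^sup>2 * (F 0 - fstar) + (max L0 L - L0) * m)
            / ((2 * \<alpha> - 1) * L0\<^sup>2)"
proof -
  define M where "M = max L0 L"
  have pos: "M > 0" "\<alpha> > 0" "2 * \<alpha> - 1 > 0"
    using L0 alpha by (auto simp: M_def)
  have "(\<gamma> (Suc n) - L0) * m / (2 * \<alpha>\<^sup>2 * L0\<^sup>2) \<le> (M - L0) * m / (2 * \<alpha>\<^sup>2 * L0\<^sup>2)"
    unfolding M_def using gamma_le[of n] m_nonneg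
    by (intro divide_right_mono mult_right_mono) auto
  with telescoped_descent[of n] assms[of n]
  have "(2 * \<alpha> - 1) / (4 * \<alpha>\<^sup>2 * M) * (\<Sum>k<n. N k)
      \<le> F 0 - fstar + (M - L0) * m / (2 * \<alpha>\<^sup>2 * L0\<^sup>2)"
    unfolding M_def by linarith
  \<comment> \<open>The factor is the reciprocal of the descent coefficient.\<close>
  then have "(4 * \<alpha>\<^sup>2 * M) / (2 * \<alpha> - 1) * ((2 * \<alpha> - 1) / (4 * \<alpha>\<^sup>2 * M) * (\<Sum>k<n. N k))
      \<le> (4 * \<alpha>\<^sup>2 * M) / (2 * \<alpha> - 1) * (F 0 - fstar + (M - L0) * m / (2 * \<alpha>\<^sup>2 * L0\<^sup>2))"
    using pos by (intro mult_left_mono) auto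
  also have "\<dots> = 2 * M * (2 * \<alpha>\<^sup>2 * L0\<^sup>2 * (F 0 - fstar) + (M - L0) * m)
            / ((2 * \<alpha> - 1) * L0\<^sup>2)"
    using pos L0 by (simp add: field_simps)
  finally show ?thesis
    using pos by (simp add: M_def)
qed

end

text \<open>Finiteness of \<open>S_bar\<close> leaves a tail of descent steps only; there
  \<open>F\<close> is nonincreasing and bounded below.\<close>

lemma F_convergent: "convergent F"
proof -
  obtain k0 where k0: "S_bar \<alpha> Ls \<subseteq> {..k0}"
    using finite_S_bar finite_nat_iff_bounded_le by blast
  have "decseq (\<lambda>n. F (n + k0))"
  proof (rule decseq_SucI)
    fix n
    have "Suc (n + k0) \<notin> S_bar \<alpha> Ls"
      using k0 by auto
    moreover have "0 \<le> (2 * \<alpha> - 1) / (4 * \<alpha>\<^sup>2 * max L0 L) * N (n + k0)"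
      using alpha L0 N_nonneg by (intro mult_nonneg_nonneg divide_nonneg_nonneg) auto
    ultimately show "F (Suc n + k0) \<le> F (n + k0)"
      using descent_S[of "n + k0"] by simp
  qed
  moreover obtain b where "\<And>k. b \<le> F k"
    using F_bdd by (auto simp: bdd_below_def)
  ultimately have "convergent (\<lambda>n. F (n + k0))"
    by (metis decseq_convergent convergentI)
  then show ?thesis
    by (simp add: convergent_ignore_initial_segment)
qed

lemma N_tendsto_0: "N \<longlonglongrightarrow> 0"
proof -
  obtain b where b: "\<And>k. b \<le> F k"
    using F_bdd by (auto simp: bdd_below_def)
  \<comment> \<open>Inserting 0 keeps \<open>Max\<close> meaningful for empty \<open>S_bar\<close>
    and makes \<open>m\<close> nonnegative; step l uses the gradient at iterate l - 1.\<close>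
  define m where "m = Max (insert 0 ((\<lambda>l. N (l - 1)) ` S_bar \<alpha> Ls))"
  have "N k \<le> m" if "Suc k \<in> S_bar \<alpha> Ls" for k
    unfolding m_def using that finite_S_bar
    by (intro Max_ge) (auto intro: rev_image_eqI)
  moreover have "0 \<le> m"
    unfolding m_def using finite_S_bar by (intro Max_ge) auto
  ultimately have "(\<Sum>k\<le>n. N k) \<le> 2 * max L0 L * (2 * \<alpha>\<^sup>2 * L0\<^sup>2 * (F 0 - b) + (max L0 L - L0) * m)
      / ((2 * \<alpha> - 1) * L0\<^sup>2)" for n
    unfolding lessThan_Suc_atMost[symmetric] using b by (intro sum_N_le) auto
  with N_nonneg have "summable N"
    by (rule bounded_imp_summable)
  then show ?thesis
    by (rule summable_LIMSEQ_zero)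
qed

end

section \<open>Tangent vectors in coordinates\<close>

locale manifold =
  fixes X :: "'m topology" and A :: "('m, 'e::euclidean_space) chart set"
  assumes smooth_manifold: "smooth_manifold X A"
begin

section \<open>Charts, overlaps and the chain rule\<close>

lemma chart_homeomorphic:
  "c \<in> A \<Longrightarrow> homeomorphic_map (subtopology X (fst c)) (top_of_set (chart_range c)) (snd c)"
  and chart_openin: "c \<in> A \<Longrightarrow> openin X (fst c)"
  and chart_range_open: "c \<in> A \<Longrightarrow> open (chart_range c)"
  and chart_smooth: "c \<in> A \<Longrightarrow> d \<in> A \<Longrightarrow> smooth_on (snd c ` (fst c \<inter> fst d)) (snd d \<circ> chart_inv c)"
  using smooth_manifold by (auto simp: smooth_manifold_def)

lemma obtain_chart:
  assumes "y \<in> topspace X"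
  obtains c where "c \<in> charts_at A y"
proof -
  have "y \<in> (\<Union>c\<in>A. fst c)"
    using assms smooth_manifold unfolding smooth_manifold_def by blast
  then obtain c where "c \<in> A" "y \<in> fst c"
    by blast
  then show thesis
    by (intro that) (simp add: charts_at_def)
qed

lemma chart_inj_on: "c \<in> A \<Longrightarrow> inj_on (snd c) (fst c)"
  using homeomorphic_imp_injective_map[OF chart_homeomorphic[of c]]
    openin_subset[OF chart_openin[of c]]
  by (simp add: Int_absorb1)

lemma chart_inv_chart: "c \<in> charts_at A y \<Longrightarrow> chart_inv c (snd c y) = y"
  by (auto simp: charts_at_def chart_inv_def intro: inv_into_f_f chart_inj_on)

lemma chart_in_range: "c \<in> charts_at A y \<Longrightarrow> snd c y \<in> chart_range c"
  by (auto simp: charts_at_def chart_range_def)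

text \<open>A chart is a homeomorphism onto an open range, so relative openness there is openness in
  the Euclidean space. Derivatives can then be computed on the overlap alone.\<close>

lemma overlap_open:
  assumes "c \<in> A" "d \<in> A"
  shows "open (snd c ` (fst c \<inter> fst d))"
proof -
  have "openin (subtopology X (fst c)) (fst c \<inter> fst d)"
    using assms chart_openin by (metis inf_commute openin_subtopology_Int)
  then have "openin (top_of_set (chart_range c)) (snd c ` (fst c \<inter> fst d))"
    using homeomorphic_imp_open_map[OF chart_homeomorphic[OF assms(1)]] by (auto simp: open_map_def)
  then show ?thesis
    using assms(1) chart_range_open openin_open_eq by blast
qed

lemma transition_differentiable:
  assumes "c \<in> charts_at A y" "d \<in> charts_at A y"
  shows "(snd d \<circ> chart_inv c) differentiable (at (snd c y))"
proof -
  have "Ck_on (Suc 0) (snd c ` (fst c \<inter> fst d)) (snd d \<circ> chart_inv c)"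
    using chart_smooth[of c d] assms by (auto simp: smooth_on_def charts_at_def simp del: Ck_on.simps)
  then show ?thesis
    using assms by (auto simp: charts_at_def)
qed

text \<open>The chain rule for h o c^-1 = (h o d^-1) o (d o c^-1). It serves with \<open>h\<close>
  the function f, for differentials, and with \<open>h\<close> a third chart, for compatibility of
  coordinates.\<close>

lemma change_of_chart:
  assumes c: "c \<in> charts_at A y" and d: "d \<in> charts_at A y"
    and "(h \<circ> chart_inv d) differentiable (at (snd d y))"
  shows "frechet_derivative (h \<circ> chart_inv c) (at (snd c y)) v =
    frechet_derivative (h \<circ> chart_inv d) (at (snd d y))
      (frechet_derivative (snd d \<circ> chart_inv c) (at (snd c y)) v)"
proof -
  let ?Dd = "frechet_derivative (h \<circ> chart_inv d) (at (snd d y))"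
  let ?Dc = "frechet_derivative (snd d \<circ> chart_inv c) (at (snd c y))"
  have "((snd d \<circ> chart_inv c) has_derivative ?Dc) (at (snd c y))"
    using transition_differentiable[OF c d] frechet_derivative_works by blast
  moreover have "((h \<circ> chart_inv d) has_derivative ?Dd) (at ((snd d \<circ> chart_inv c) (snd c y)))"
    using assms frechet_derivative_works by (auto simp: chart_inv_chart)
  ultimately have "((h \<circ> chart_inv d) \<circ> (snd d \<circ> chart_inv c) has_derivative ?Dd \<circ> ?Dc) (at (snd c y))"
    by (rule diff_chain_at)
  \<comment> \<open>Outside the chart range \<open>chart_inv\<close> is arbitrary; equality on the
    image of the overlap, an open neighbourhood of \<open>snd c y\<close>, determines the
    derivative.\<close>
  moreover have "((h \<circ> chart_inv d) \<circ> (snd d \<circ> chart_inv c)) u = (h \<circ> chart_inv c) u"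
    if u: "u \<in> snd c ` (fst c \<inter> fst d)" for u
  proof -
    obtain z where z: "u = snd c z" "z \<in> fst c" "z \<in> fst d"
      using u by blast
    with c d have "c \<in> charts_at A z" "d \<in> charts_at A z"
      by (auto simp: charts_at_def)
    then show ?thesis
      by (simp add: z chart_inv_chart)
  qed
  moreover have "open (snd c ` (fst c \<inter> fst d))" "snd c y \<in> snd c ` (fst c \<inter> fst d)"
    using c d by (auto simp: charts_at_def intro: overlap_open)
  ultimately have "((h \<circ> chart_inv c) has_derivative ?Dd \<circ> ?Dc) (at (snd c y))"
    by (metis (no_types, lifting) has_derivative_transform_within_open)
  then show ?thesis
    by (simp flip: frechet_derivative_at)
qed

section \<open>Coordinates on the tangent spaces\<close>

lemma linear_transition:
  assumes "c \<in> charts_at A y" "d \<in> charts_at A y"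
  shows "linear (frechet_derivative (snd d \<circ> chart_inv c) (at (snd c y)))"
  using transition_differentiable[OF assms] by (rule linear_frechet_derivative)

lemma tangent_of_self:
  assumes c: "c \<in> charts_at A y"
  shows "tangent_of A c y v c = v"
proof -
  have "(id has_derivative id) (at (snd c y))"
    by (rule has_derivative_id)
  moreover have "id u = (snd c \<circ> chart_inv c) u" if "u \<in> chart_range c" for u
    using that by (auto simp: chart_inv_def chart_range_def f_inv_into_f)
  ultimately have "((snd c \<circ> chart_inv c) has_derivative id) (at (snd c y))"
    using c by (metis (no_types, lifting) has_derivative_transform_within_open chart_in_range
        chart_range_open charts_at_def mem_Collect_eq)
  then show ?thesis
    using c by (simp add: tangent_of_def flip: frechet_derivative_at)
qed

lemma tangent_of_in_tangent_space:
  assumes c: "c \<in> charts_at A y"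
  shows "tangent_of A c y v \<in> tangent_space A y"
  unfolding tangent_space_def mem_Collect_eq
proof (intro conjI allI impI ballI)
  fix d d'
  assume d: "d \<in> charts_at A y" "d' \<in> charts_at A y"
  show "tangent_of A c y v d' =
      frechet_derivative (snd d' \<circ> chart_inv d) (at (snd d y)) (tangent_of A c y v d)"
    using change_of_chart[OF c d(1) transition_differentiable[OF d]] d by (simp add: tangent_of_def)
qed (simp add: tangent_of_def)

text \<open>With \<open>tangent_of_self\<close> this makes \<open>tangent_of A c y\<close> a
  bijection from the coordinate space onto the tangent space, through which linear algebra is
  transferred.\<close>

lemma tangent_of_coordinate:
  assumes "c \<in> charts_at A y" "\<xi> \<in> tangent_space A y"
  shows "tangent_of A c y (\<xi> c) = \<xi>"
proof
  fix d
  have "d \<notin> charts_at A y \<Longrightarrow> \<xi> d = 0"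
    and "d \<in> charts_at A y \<Longrightarrow> \<xi> d = frechet_derivative (snd d \<circ> chart_inv c) (at (snd c y)) (\<xi> c)"
    using assms unfolding tangent_space_def by blast+
  then show "tangent_of A c y (\<xi> c) d = \<xi> d"
    unfolding tangent_of_def by presburger
qed

lemma tangent_of_add:
  assumes c: "c \<in> charts_at A y"
  shows "tangent_of A c y (v + w) = tangent_of A c y v + tangent_of A c y w"
  using linear_transition[OF c] by (auto simp: tangent_of_def fun_eq_iff linear_add)

lemma tangent_of_scaleR:
  assumes c: "c \<in> charts_at A y"
  shows "tangent_of A c y (a *\<^sub>R v) = a *\<^sub>R tangent_of A c y v"
  using linear_transition[OF c] by (auto simp: tangent_of_def fun_eq_iff scaleR_fun_def linear_cmul)

lemma tangent_of_eq_0_iff: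
  assumes c: "c \<in> charts_at A y"
  shows "tangent_of A c y v = 0 \<longleftrightarrow> v = 0"
  by (metis tangent_of_self[OF c] tangent_of_scaleR[OF c, of 0 v] scale_zero_left zero_fun_apply)

lemma tangent_space_add:
  assumes "y \<in> topspace X" "\<xi> \<in> tangent_space A y" "\<eta> \<in> tangent_space A y"
  shows "\<xi> + \<eta> \<in> tangent_space A y"
proof -
  obtain c where c: "c \<in> charts_at A y"
    using assms(1) by (rule obtain_chart)
  show ?thesis
    using tangent_of_add[OF c] tangent_of_coordinate[OF c] tangent_of_in_tangent_space[OF c] assms
    by metis
qed

lemma tangent_space_scaleR:
  assumes "y \<in> topspace X" "\<xi> \<in> tangent_space A y"
  shows "a *\<^sub>R \<xi> \<in> tangent_space A y"
proof -
  obtain c where c: "c \<in> charts_at A y"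
    using assms(1) by (rule obtain_chart)
  show ?thesis
    using tangent_of_scaleR[OF c] tangent_of_coordinate[OF c] tangent_of_in_tangent_space[OF c] assms
    by metis
qed

lemma C1_function_differentiable:
  assumes "C1_function A f" "c \<in> charts_at A y"
  shows "(f \<circ> chart_inv c) differentiable (at (snd c y))"
  using assms by (auto simp: C1_function_def charts_at_def chart_range_def)

lemma differential_tangent_of:
  assumes f: "C1_function A f" and c: "c \<in> charts_at A y"
  shows "differential A f y (tangent_of A c y v) = frechet_derivative (f \<circ> chart_inv c) (at (snd c y)) v"
proof -
  \<comment> \<open>The chart chosen inside \<open>differential\<close>; the change of chart trades
    it for \<open>c\<close>.\<close>
  define d where "d = (SOME d. d \<in> charts_at A y)"
  have d: "d \<in> charts_at A y"
    unfolding d_def using c by (rule someI)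
  have "differential A f y (tangent_of A c y v) =
      frechet_derivative (f \<circ> chart_inv d) (at (snd d y)) (tangent_of A c y v d)"
    by (simp add: differential_def Let_def d_def)
  also have "\<dots> = frechet_derivative (f \<circ> chart_inv c) (at (snd c y)) v"
    using change_of_chart[OF c d C1_function_differentiable[OF f d]] d by (simp add: tangent_of_def)
  finally show ?thesis .
qed

end

section \<open>The Riemannian gradient\<close>

locale riemannian = manifold X A
  for X :: "'m topology" and A :: "('m, 'e::euclidean_space) chart set" +
  fixes g :: "'m \<Rightarrow> ('m, 'e) tangent \<Rightarrow> ('m, 'e) tangent \<Rightarrow> real"
  assumes metric: "riemannian_metric X A g"
begin

section \<open>Inner product geometry of one tangent space\<close>

context
  fixes y
  assumes y: "y \<in> topspace X"
begin

lemma g_commute: "\<xi> \<in> tangent_space A y \<Longrightarrow> \<eta> \<in> tangent_space A y \<Longrightarrow> g y \<xi> \<eta> = g y \<eta> \<xi>"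
  and g_add_left: "\<xi> \<in> tangent_space A y \<Longrightarrow> \<eta> \<in> tangent_space A y \<Longrightarrow> \<zeta> \<in> tangent_space A y \<Longrightarrow>
    g y (\<xi> + \<eta>) \<zeta> = g y \<xi> \<zeta> + g y \<eta> \<zeta>"
  and g_scaleR_left: "\<xi> \<in> tangent_space A y \<Longrightarrow> \<eta> \<in> tangent_space A y \<Longrightarrow>
    g y (a *\<^sub>R \<xi>) \<eta> = a * g y \<xi> \<eta>"
  and g_pos: "\<xi> \<in> tangent_space A y \<Longrightarrow> \<xi> \<noteq> 0 \<Longrightarrow> g y \<xi> \<xi> > 0"
  using metric y by (auto simp: riemannian_metric_def)

lemma g_scaleR_right: "\<xi> \<in> tangent_space A y \<Longrightarrow> \<eta> \<in> tangent_space A y \<Longrightarrow>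
    g y \<xi> (a *\<^sub>R \<eta>) = a * g y \<xi> \<eta>"
  using y by (simp add: g_commute[of \<xi>] g_scaleR_left tangent_space_scaleR)

lemma g_add_right: "\<xi> \<in> tangent_space A y \<Longrightarrow> \<eta> \<in> tangent_space A y \<Longrightarrow> \<zeta> \<in> tangent_space A y \<Longrightarrow>
    g y \<zeta> (\<xi> + \<eta>) = g y \<zeta> \<xi> + g y \<zeta> \<eta>"
  using y by (simp add: g_commute[of \<zeta>] g_add_left tangent_space_add)

lemma g_nonneg:
  assumes "\<xi> \<in> tangent_space A y"
  shows "g y \<xi> \<xi> \<ge> 0"
  using g_pos[OF assms] g_scaleR_left[OF assms assms, of 0] by (cases "\<xi> = 0") auto

lemma tnorm_nonneg: "\<xi> \<in> tangent_space A y \<Longrightarrow> 0 \<le> tnorm g y \<xi>"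
  by (simp add: tnorm_def g_nonneg)

lemma tnorm_power2: "\<xi> \<in> tangent_space A y \<Longrightarrow> (tnorm g y \<xi>)\<^sup>2 = g y \<xi> \<xi>"
  by (simp add: tnorm_def g_nonneg)

lemma tnorm_scaleR_power2:
  "\<xi> \<in> tangent_space A y \<Longrightarrow> (tnorm g y (a *\<^sub>R \<xi>))\<^sup>2 = a\<^sup>2 * g y \<xi> \<xi>"
  using y by (simp add: tnorm_power2 tangent_space_scaleR g_scaleR_left g_scaleR_right)
     (simp add: power2_eq_square)

lemma g_Cauchy_Schwarz:
  assumes \<xi>: "\<xi> \<in> tangent_space A y" and \<eta>: "\<eta> \<in> tangent_space A y"
  shows "\<bar>g y \<xi> \<eta>\<bar> \<le> tnorm g y \<xi> * tnorm g y \<eta>"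
proof (cases "\<eta> = 0")
  case True
  then show ?thesis
    using g_scaleR_right[OF \<xi> \<eta>, of 0] tnorm_nonneg[OF \<xi>] tnorm_nonneg[OF \<eta>] by auto
next
  case False
  \<comment> \<open>The minimiser of the squared norm of \<xi> + t \<eta> over t.\<close>
  define t where "t = - g y \<xi> \<eta> / g y \<eta> \<eta>"
  note pos = g_pos[OF \<eta> False]
  have t\<eta>: "t *\<^sub>R \<eta> \<in> tangent_space A y"
    using y \<eta> by (rule tangent_space_scaleR)
  have "0 \<le> g y (\<xi> + t *\<^sub>R \<eta>) (\<xi> + t *\<^sub>R \<eta>)"
    using y \<xi> t\<eta> by (intro g_nonneg tangent_space_add)
  also have "\<dots> = g y \<xi> \<xi> + 2 * t * g y \<xi> \<eta> + t\<^sup>2 * g y \<eta> \<eta>"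
    using y \<xi> \<eta> t\<eta>
    by (simp add: g_add_left g_add_right g_scaleR_left g_scaleR_right tangent_space_add
        g_commute[of \<eta> \<xi>] power2_eq_square algebra_simps)
  also have "\<dots> = g y \<xi> \<xi> - (g y \<xi> \<eta>)\<^sup>2 / g y \<eta> \<eta>"
    using pos by (simp add: t_def field_simps power2_eq_square)
  finally have "(g y \<xi> \<eta>)\<^sup>2 \<le> g y \<xi> \<xi> * g y \<eta> \<eta>"
    using pos by (simp add: field_simps)
  then have "sqrt ((g y \<xi> \<eta>)\<^sup>2) \<le> sqrt (g y \<xi> \<xi> * g y \<eta> \<eta>)"
    by (rule real_sqrt_le_mono)
  then show ?thesis
    by (simp add: tnorm_def real_sqrt_mult)
qed

text \<open>Riesz representation in coordinates. The map \<open>\<Phi>\<close> collects the values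
  of the form on the standard basis; it is injective by positive definiteness, hence surjective by
  finite dimension.\<close>

lemma tangent_Riesz:
  assumes c: "c \<in> charts_at A y" and \<phi>: "linear \<phi>"
  shows "\<exists>w. \<forall>v. g y (tangent_of A c y w) (tangent_of A c y v) = \<phi> v"
proof -
  define B where "B v w = g y (tangent_of A c y v) (tangent_of A c y w)" for v w
  have lin_right: "linear (B v)" for v
    by (rule linearI) (simp_all add: B_def tangent_of_add[OF c] tangent_of_scaleR[OF c]
        g_add_right g_scaleR_right tangent_of_in_tangent_space[OF c])
  have B_add: "B (v + v') w = B v w + B v' w" and B_scaleR: "B (a *\<^sub>R v) w = a * B v w" for v v' w a
    by (simp_all add: B_def tangent_of_add[OF c] tangent_of_scaleR[OF c]
        g_add_left g_scaleR_left tangent_of_in_tangent_space[OF c])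
  define \<Phi> where "\<Phi> w = (\<Sum>b\<in>Basis. B w b *\<^sub>R b)" for w
  have \<Phi>_inner: "\<Phi> w \<bullet> b = B w b" if "b \<in> Basis" for w b
    using that by (simp add: \<Phi>_def)
  have lin: "linear \<Phi>"
    by (rule linearI) (simp_all add: \<Phi>_def B_add B_scaleR scaleR_left_distrib sum.distrib scaleR_sum_right)
  have "inj \<Phi>"
  proof (rule linear_injective_0[OF lin, THEN iffD2], intro allI impI)
    fix w assume "\<Phi> w = 0"
    then have "B w b = 0" if "b \<in> Basis" for b
      using \<Phi>_inner[OF that, of w] by simp
    \<comment> \<open>Linearity in the second argument carries the vanishing from the basis to
      \<open>w\<close> itself, where definiteness applies.\<close>
    then have "B w w = 0"
      using linear_eq_on_span[OF lin_right linear_zero, of Basis w] by auto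
    then show "w = 0"
      using g_pos[OF tangent_of_in_tangent_space[OF c], of w] tangent_of_eq_0_iff[OF c]
      by (auto simp: B_def)
  qed
  then have "surj \<Phi>"
    using lin by (simp add: linear_injective_imp_surjective)
  then obtain w where w: "\<Phi> w = (\<Sum>b\<in>Basis. \<phi> b *\<^sub>R b)"
    by (metis surjD)
  have "B w b = \<phi> b" if "b \<in> Basis" for b
    using \<Phi>_inner[OF that, of w] that by (simp add: w)
  then have "B w v = \<phi> v" for v
    using linear_eq_on_span[OF lin_right \<phi>, of Basis w v] by auto
  then show ?thesis
    by (auto simp: B_def)
qed

text \<open>Justifies the \<open>THE\<close> in \<open>grad\<close>. Existence is Riesz
  representation; for uniqueness, the difference of two candidates is orthogonal to itself.\<close>

lemma grad_characterization:
  assumes f: "C1_function A f"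
  shows "\<exists>!\<eta>. \<eta> \<in> tangent_space A y \<and> (\<forall>\<xi>\<in>tangent_space A y. g y \<eta> \<xi> = differential A f y \<xi>)"
proof (rule ex_ex1I)
  obtain c where c: "c \<in> charts_at A y"
    using y by (rule obtain_chart)
  have "linear (frechet_derivative (f \<circ> chart_inv c) (at (snd c y)))"
    using C1_function_differentiable[OF f c] by (rule linear_frechet_derivative)
  then obtain w where w: "g y (tangent_of A c y w) (tangent_of A c y v) = differential A f y (tangent_of A c y v)" for v
    using tangent_Riesz[OF c] differential_tangent_of[OF f c] by metis
  then show "\<exists>\<eta>. \<eta> \<in> tangent_space A y \<and> (\<forall>\<xi>\<in>tangent_space A y. g y \<eta> \<xi> = differential A f y \<xi>)"
    by (metis c tangent_of_in_tangent_space tangent_of_coordinate)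
next
  fix \<eta> \<zeta>
  assume \<eta>: "\<eta> \<in> tangent_space A y \<and> (\<forall>\<xi>\<in>tangent_space A y. g y \<eta> \<xi> = differential A f y \<xi>)"
    and \<zeta>: "\<zeta> \<in> tangent_space A y \<and> (\<forall>\<xi>\<in>tangent_space A y. g y \<zeta> \<xi> = differential A f y \<xi>)"
  have minus: "(- 1) *\<^sub>R \<zeta> \<in> tangent_space A y"
    using y \<zeta> by (intro tangent_space_scaleR) auto
  then have \<delta>: "\<eta> + (- 1) *\<^sub>R \<zeta> \<in> tangent_space A y"
    using y \<eta> by (intro tangent_space_add) auto
  have "g y (\<eta> + (- 1) *\<^sub>R \<zeta>) (\<eta> + (- 1) *\<^sub>R \<zeta>)
      = g y \<eta> (\<eta> + (- 1) *\<^sub>R \<zeta>) + (- 1) * g y \<zeta> (\<eta> + (- 1) *\<^sub>R \<zeta>)"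
    using \<eta> \<zeta> minus \<delta> by (metis g_add_left g_scaleR_left)
  also have "\<dots> = 0"
    using \<eta> \<zeta> \<delta> by simp
  finally have "\<eta> + (- 1) *\<^sub>R \<zeta> = 0"
    using g_pos[OF \<delta>] by force
  then show "\<eta> = \<zeta>"
    by simp
qed

context
  fixes f
  assumes f: "C1_function A f"
begin

lemma grad_in_tangent_space: "grad A g f y \<in> tangent_space A y"
  and g_grad: "\<xi> \<in> tangent_space A y \<Longrightarrow> g y (grad A g f y) \<xi> = differential A f y \<xi>"
  unfolding grad_def using theI'[OF grad_characterization[OF f]] by blast+

text \<open>The differential vanishes, and its value on the gradient is the squared norm of the
  gradient.\<close>

lemma grad_eq_0I:
  assumes c: "c \<in> charts_at A y"
    and "\<And>v. frechet_derivative (f \<circ> chart_inv c) (at (snd c y)) v = 0"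
  shows "grad A g f y = 0"
proof -
  have "g y (grad A g f y) (grad A g f y) = 0"
    using g_grad[OF grad_in_tangent_space] differential_tangent_of[OF f c]
      tangent_of_coordinate[OF c grad_in_tangent_space] assms(2) by metis
  then show ?thesis
    using g_pos[OF grad_in_tangent_space] by force
qed

end

end

lemma grad_limit_eq_0:
  assumes f: "C1_function A f"
    and lim: "limitin X z xs sequentially"
    and z: "\<And>n. z n \<in> topspace X"
    and grad: "(\<lambda>n. tnorm g (z n) (grad A g f (z n))) \<longlonglongrightarrow> 0"
  shows "grad A g f xs = 0"
proof -
  have xs: "xs \<in> topspace X"
    using lim by (rule limitin_topspace)
  then obtain c where c: "c \<in> charts_at A xs"
    by (rule obtain_chart)
  then have cA: "c \<in> A" and xs_c: "xs \<in> fst c"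
    by (auto simp: charts_at_def)
  have ev: "\<forall>\<^sub>F n in sequentially. z n \<in> fst c"
    using lim chart_openin[OF cA] xs_c by (auto simp: limitin_def)
  then have ev_c: "\<forall>\<^sub>F n in sequentially. c \<in> charts_at A (z n)"
    using cA by (auto simp: charts_at_def)
  \<comment> \<open>A tail of the sequence lies in the chart domain, where the chart turns
    convergence in the manifold into convergence of coordinates.\<close>
  have "limitin (subtopology X (fst c)) z xs sequentially"
    using lim ev xs_c by (simp add: limitin_subtopology)
  from continuous_map_limit[OF homeomorphic_imp_continuous_map[OF chart_homeomorphic[OF cA]] this]
  have tend: "(\<lambda>n. snd c (z n)) \<longlonglongrightarrow> snd c xs"
    and ev_range: "\<forall>\<^sub>F n in sequentially. snd c (z n) \<in> chart_range c"
    by (simp_all add: limitin_subtopology o_def)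
  have coordinate_limit: "(\<lambda>n. h (snd c (z n))) \<longlonglongrightarrow> h (snd c xs)"
    if "continuous_on (chart_range c) h" for h :: "'e \<Rightarrow> real"
    using that tend chart_in_range[OF c] ev_range by (rule continuous_on_tendsto_compose)
  have "frechet_derivative (f \<circ> chart_inv c) (at (snd c xs)) v = 0" for v
  proof -
    let ?D = "\<lambda>u. frechet_derivative (f \<circ> chart_inv c) (at u) v"
    \<comment> \<open>The squared length of the vector with constant coordinates \<open>v\<close>:
      continuous because the metric is smooth, so it converges along \<open>z\<close>.\<close>
    let ?G = "\<lambda>u. g (chart_inv c u) (tangent_of A c (chart_inv c u) v) (tangent_of A c (chart_inv c u) v)"
    have "continuous_on (chart_range c) ?D"
      using f cA by (simp add: C1_function_def)
    then have D: "(\<lambda>n. ?D (snd c (z n))) \<longlonglongrightarrow> ?D (snd c xs)"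
      by (rule coordinate_limit)
    have "smooth_on (chart_range c) ?G"
      using metric cA by (auto simp: riemannian_metric_def)
    then have "Ck_on 0 (chart_range c) ?G"
      unfolding smooth_on_def by blast
    then have "continuous_on (chart_range c) ?G"
      by simp
    then have "(\<lambda>n. ?G (snd c (z n))) \<longlonglongrightarrow> ?G (snd c xs)"
      by (rule coordinate_limit)
    then have "(\<lambda>n. tnorm g (z n) (grad A g f (z n)) * sqrt (?G (snd c (z n))))
        \<longlonglongrightarrow> 0 * sqrt (?G (snd c xs))"
      using grad by (intro tendsto_intros)
    moreover have "\<forall>\<^sub>F n in sequentially. norm (?D (snd c (z n)))
        \<le> tnorm g (z n) (grad A g f (z n)) * sqrt (?G (snd c (z n)))"
      using ev_c
    proof eventually_elim
      case (elim n)
      have "?D (snd c (z n)) = g (z n) (grad A g f (z n)) (tangent_of A c (z n) v)"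
        using elim z f by (simp add: g_grad tangent_of_in_tangent_space differential_tangent_of)
      then show ?case
        using g_Cauchy_Schwarz[OF z grad_in_tangent_space[OF z f] tangent_of_in_tangent_space[OF elim]]
        by (simp add: tnorm_def chart_inv_chart[OF elim])
    qed
    ultimately have "(\<lambda>n. ?D (snd c (z n))) \<longlonglongrightarrow> 0"
      by (auto intro: Lim_null_comparison)
    with D show ?thesis
      by (rule LIMSEQ_unique)
  qed
  with xs f c show ?thesis
    by (intro grad_eq_0I)
qed

end

section \<open>Convergence of the method\<close>

theorem theorem3p2:
  fixes X :: "'m topology"
    and A :: "('m, 'e::euclidean_space) chart set"
    and g :: "'m \<Rightarrow> ('m, 'e) tangent \<Rightarrow> ('m, 'e) tangent \<Rightarrow> real"
    and f :: "'m \<Rightarrow> real"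
    and R :: "'m \<Rightarrow> ('m, 'e) tangent \<Rightarrow> 'm"
    and L \<alpha> L0 :: real
    and x0 :: 'm
    and x :: "nat \<Rightarrow> 'm"
    and Ls :: "nat \<Rightarrow> real"
  assumes "riemannian_manifold X A g"
    and "C1_function A f"
    and "bdd_below (f ` topspace X)"
    and "manifold_retraction X A R"
    and "L > 0"
    and "\<forall>(y, \<xi>)\<in>tangent_bundle X A.
           f (R y \<xi>) \<le> f y + g y (grad A g f y) \<xi> + L / 2 * (tnorm g y \<xi>)\<^sup>2"
    and "\<alpha> > 1 / 2" and "L0 > 0" and "x0 \<in> topspace X"
    and "AC_RGM A g f R \<alpha> L0 x0 x Ls"
    and "\<forall>k\<ge>1. grad A g f (x (k - 1)) \<noteq> 0"
  shows
    "(\<exists>m. is_max0 m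
            ((\<lambda>l. (tnorm g (x (l - 1)) (grad A g f (x (l - 1))))\<^sup>2) ` S_bar \<alpha> Ls) \<and>
          (let fstar = (INF y\<in>topspace X. f y);
               \<Delta> = f x0 - fstar;
               C = (max L0 L - L0) * m;
               bound = (\<lambda>k::nat. sqrt (2 * max L0 L * (2 * \<alpha>\<^sup>2 * L0\<^sup>2 * \<Delta> + C)
                                       / ((2 * \<alpha> - 1) * L0\<^sup>2 * real k)))
           in (\<forall>k\<ge>1. Min ((\<lambda>l. tnorm g (x (l - 1)) (grad A g f (x (l - 1)))) ` {1..k})
                       \<le> bound k) \<and>
              bound \<in> O(\<lambda>k. real k powr (- 1 / 2))))
     \<and> convergent (\<lambda>k. f (x k))
     \<and> (\<forall>r xs. strict_mono r \<and> limitin X (x \<circ> r) xs sequentially \<longrightarrow> grad A g f xs = 0)"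
proof -
  interpret riemannian X A g
    using assms(1) by unfold_locales (auto simp: riemannian_manifold_def)
  define G where "G k = grad A g f (x k)" for k
  define N where "N k = g (x k) (G k) (G k)" for k
  define \<tau> where "\<tau> = ac_tau \<alpha> Ls"
  define fstar where "fstar = (INF y\<in>topspace X. f y)"
  have x_0: "x 0 = x0" and Ls_0: "Ls 0 = L0"
    and x_Suc: "x (Suc k) = R (x k) (- (\<tau> (Suc k) *\<^sub>R G k))"
    and Ls_Suc: "Ls (Suc k) = 2 * (f (x (Suc k)) - f (x k) - g (x k) (G k) (- (\<tau> (Suc k) *\<^sub>R G k)))
                    / (tnorm g (x k) (\<tau> (Suc k) *\<^sub>R G k))\<^sup>2" for k
    using assms(10) unfolding AC_RGM_def by (auto simp: Let_def G_def \<tau>_def dest: spec[of _ "Suc k"])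
  note f = assms(2)
  have step: "- (a *\<^sub>R \<xi>) = (- a) *\<^sub>R \<xi>" for a and \<xi> :: "('m, 'e) tangent"
    by simp
  have x_in: "x k \<in> topspace X" for k
  proof (induction k)
    case 0
    show ?case using assms(9) x_0 by simp
  next
    case (Suc k)
    then have "- (\<tau> (Suc k) *\<^sub>R G k) \<in> tangent_space A (x k)"
      unfolding step G_def using f by (intro tangent_space_scaleR grad_in_tangent_space)
    with Suc show ?case
      using assms(4) by (auto simp: x_Suc manifold_retraction_def tangent_bundle_def)
  qed
  have G_in: "G k \<in> tangent_space A (x k)" for k
    unfolding G_def using x_in f by (rule grad_in_tangent_space)
  have G_nz: "G k \<noteq> 0" for k
    using assms(11)[rule_format, of "Suc k"] by (simp add: G_def)
  have N_pos: "N k > 0" for k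
    unfolding N_def using x_in G_in G_nz by (rule g_pos)
  have tnorm_G: "(tnorm g (x k) (G k))\<^sup>2 = N k" for k
    unfolding N_def using x_in G_in by (rule tnorm_power2)
  \<comment> \<open>Positivity of the step sizes comes before the interpretation of
    \<open>ac_estimates\<close>, whose assumptions are derived by dividing by tau^2 N.\<close>
  have L0_le_gamma: "L0 \<le> ac_gamma Ls (Suc k)" for k
    unfolding ac_gamma_def using Ls_0 by (intro Max_ge) (auto intro: rev_image_eqI)
  have \<tau>_pos: "\<tau> (Suc k) > 0" for k
    unfolding \<tau>_def ac_tau_def using L0_le_gamma[of k] assms(7,8) by simp
  have g_step: "g (x k) (G k) (- (\<tau> (Suc k) *\<^sub>R G k)) = - \<tau> (Suc k) * N k" for k
    unfolding step N_def using x_in G_in G_in by (rule g_scaleR_right)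
  have tnorm_step: "(tnorm g (x k) (\<tau> (Suc k) *\<^sub>R G k))\<^sup>2 = (\<tau> (Suc k))\<^sup>2 * N k"
    and tnorm_step': "(tnorm g (x k) (- (\<tau> (Suc k) *\<^sub>R G k)))\<^sup>2 = (\<tau> (Suc k))\<^sup>2 * N k" for k
    unfolding step N_def using tnorm_scaleR_power2[OF x_in G_in] by (metis power2_minus)+
  \<comment> \<open>The definition of L_k solved for the new value; its denominator is nonzero
    because the gradient is.\<close>
  have f_Suc: "f (x (Suc k)) = f (x k) - \<tau> (Suc k) * N k + Ls (Suc k) / 2 * (\<tau> (Suc k))\<^sup>2 * N k" for k
    using Ls_Suc[of k] \<tau>_pos[of k] N_pos[of k] unfolding g_step tnorm_step
    by (simp add: field_simps)
  have Ls_le: "Ls (Suc k) \<le> L" for k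
  proof -
    have "- (\<tau> (Suc k) *\<^sub>R G k) \<in> tangent_space A (x k)"
      unfolding step using x_in G_in by (rule tangent_space_scaleR)
    then have "(x k, - (\<tau> (Suc k) *\<^sub>R G k)) \<in> tangent_bundle X A"
      using x_in by (auto simp: tangent_bundle_def)
    with assms(6) have "f (x (Suc k)) \<le> f (x k) + g (x k) (G k) (- (\<tau> (Suc k) *\<^sub>R G k))
        + L / 2 * (tnorm g (x k) (- (\<tau> (Suc k) *\<^sub>R G k)))\<^sup>2"
      by (auto simp: x_Suc G_def)
    \<comment> \<open>The exact formula and the descent inequality differ only in the quadratic
      term.\<close>
    then have "Ls (Suc k) * ((\<tau> (Suc k))\<^sup>2 * N k) \<le> L * ((\<tau> (Suc k))\<^sup>2 * N k)"
      unfolding f_Suc g_step tnorm_step' by (simp add: algebra_simps)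
    then show ?thesis
      using \<tau>_pos[of k] N_pos[of k] by simp
  qed
  have bdd: "bdd_below (range (\<lambda>k. f (x k)))"
    using assms(3) by (rule bdd_below_mono) (use x_in in auto)
  interpret ac_estimates \<alpha> L0 L Ls "\<lambda>k. f (x k)" N
    using assms(7,8) Ls_0 Ls_le N_pos f_Suc bdd
    by unfold_locales (auto simp: \<tau>_def intro: less_imp_le)
  have fstar: "fstar \<le> f (x k)" for k
    unfolding fstar_def using assms(3) x_in by (rule cINF_lower)
  define B where "B = (\<lambda>l. N (l - 1)) ` S_bar \<alpha> Ls"
  \<comment> \<open>The case distinction is the convention that an empty maximum is 0.\<close>
  define m where "m = (if B = {} then 0 else Max B)"
  have "finite B"
    unfolding B_def using finite_S_bar by simp
  then have m_max: "is_max0 m B"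
    by (auto simp: is_max0_def m_def)
  have m_ge: "N k \<le> m" if "Suc k \<in> S_bar \<alpha> Ls" for k
  proof -
    have "N k \<in> B"
      unfolding B_def using that by (intro image_eqI[of _ _ "Suc k"]) auto
    with m_max show ?thesis
      by (auto simp: is_max0_def split: if_splits)
  qed
  have m_nonneg: "0 \<le> m"
    using m_max N_pos by (auto simp: is_max0_def B_def less_imp_le split: if_splits)
  \<comment> \<open>Chosen so that the asserted bound is the root of K / k.\<close>
  define K where "K = 2 * max L0 L * (2 * \<alpha>\<^sup>2 * L0\<^sup>2 * (f x0 - fstar) + (max L0 L - L0) * m)
                        / ((2 * \<alpha> - 1) * L0\<^sup>2)"
  have sum_le: "(\<Sum>k<n. N k) \<le> K" for n
    using sum_N_le[of m fstar n] m_ge m_nonneg fstar by (simp add: K_def x_0)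
  have bound_eq: "2 * max L0 L * (2 * \<alpha>\<^sup>2 * L0\<^sup>2 * (f x0 - fstar) + (max L0 L - L0) * m)
                   / ((2 * \<alpha> - 1) * L0\<^sup>2 * real k) = K / real k" for k
    by (simp add: K_def)
  have Min_le: "Min ((\<lambda>l. tnorm g (x (l - 1)) (grad A g f (x (l - 1)))) ` {1..k}) \<le> sqrt (K / real k)"
    if "k \<ge> 1" for k
  proof -
    define \<mu> where "\<mu> = Min ((\<lambda>l. tnorm g (x (l - 1)) (G (l - 1))) ` {1..k})"
    have \<mu>_le: "\<mu> \<le> tnorm g (x i) (G i)" if "i < k" for i
      unfolding \<mu>_def using that by (intro Min_le) (auto intro!: image_eqI[of _ _ "Suc i"])
    have "\<mu> \<in> (\<lambda>l. tnorm g (x (l - 1)) (G (l - 1))) ` {1..k}"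
      unfolding \<mu>_def using that by (intro Min_in) auto
    then have "0 \<le> \<mu>"
      using tnorm_nonneg[OF x_in G_in] by auto
    then have "\<mu>\<^sup>2 \<le> N i" if "i < k" for i
      using power_mono[OF \<mu>_le[OF that], of 2] by (simp add: tnorm_G)
    \<comment> \<open>The minimum squared, taken k times, is at most the sum of the k squared
      norms.\<close>
    then have "(\<Sum>i<k. \<mu>\<^sup>2) \<le> (\<Sum>i<k. N i)"
      by (intro sum_mono) auto
    with sum_le[of k] have "real k * \<mu>\<^sup>2 \<le> K"
      by simp
    then have "\<mu>\<^sup>2 \<le> K / real k"
      using that by (simp add: field_simps)
    then have "\<mu> \<le> sqrt (K / real k)"
      by (rule real_le_rsqrt)
    then show ?thesis
      unfolding \<mu>_def G_def .
  qed
  have "(\<lambda>k. sqrt (K / real k)) \<in> O(\<lambda>k. real k powr (- 1 / 2))"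
  proof (rule bigoI)
    \<comment> \<open>The constant rests on |sqrt K| = sqrt |K|, valid for either sign of
      \<open>K\<close>.\<close>
    show "\<forall>\<^sub>F k in sequentially. norm (sqrt (K / real k)) \<le> sqrt \<bar>K\<bar> * norm (real k powr (- 1 / 2))"
      using eventually_gt_at_top[of "0::nat"]
    proof eventually_elim
      case (elim k)
      then have "real k powr (- 1 / 2) = 1 / sqrt (real k)"
        by (simp add: powr_minus_divide powr_half_sqrt)
      then show ?case
        by (simp add: real_sqrt_divide flip: real_sqrt_abs')
    qed
  qed
  then have rate: "\<exists>m. is_max0 m
            ((\<lambda>l. (tnorm g (x (l - 1)) (grad A g f (x (l - 1))))\<^sup>2) ` S_bar \<alpha> Ls) \<and>
          (let fstar = (INF y\<in>topspace X. f y);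
               \<Delta> = f x0 - fstar;
               C = (max L0 L - L0) * m;
               bound = (\<lambda>k::nat. sqrt (2 * max L0 L * (2 * \<alpha>\<^sup>2 * L0\<^sup>2 * \<Delta> + C)
                                       / ((2 * \<alpha> - 1) * L0\<^sup>2 * real k)))
           in (\<forall>k\<ge>1. Min ((\<lambda>l. tnorm g (x (l - 1)) (grad A g f (x (l - 1)))) ` {1..k})
                       \<le> bound k) \<and>
              bound \<in> O(\<lambda>k. real k powr (- 1 / 2)))"
    using m_max Min_le
    by (intro exI[of _ m]) (simp add: Let_def bound_eq B_def tnorm_G[unfolded G_def] flip: fstar_def)
  \<comment> \<open>Accumulation points appear as limits of subsequences, which is adequate in a
    second countable space.\<close>
  have "grad A g f xs = 0" if "strict_mono r" "limitin X (x \<circ> r) xs sequentially" for r xs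
  proof (rule grad_limit_eq_0[OF f that(2)])
    show "(x \<circ> r) n \<in> topspace X" for n
      using x_in by simp
    have "(\<lambda>n. sqrt ((N \<circ> r) n)) \<longlonglongrightarrow> sqrt 0"
      using LIMSEQ_subseq_LIMSEQ[OF N_tendsto_0 that(1)] by (rule tendsto_real_sqrt)
    then show "(\<lambda>n. tnorm g ((x \<circ> r) n) (grad A g f ((x \<circ> r) n))) \<longlonglongrightarrow> 0"
      by (simp add: tnorm_def N_def G_def)
  qed
  with rate F_convergent show ?thesis
    by blast
qed

end
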